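(* Let a $C^1$ function $V:\mathbb R^n\to\mathbb R$, the function $W$ associated with $V$, $u$, $\mu$, $\sigma$ as in the context, a simplex collection $\mathcal S=(\mathbb X_i)_{i\in\mathcal I}$, a lower margin $\underline m(V)$ of $V$ and an upper margin $\overline m(W)$ of $W$ with respect to $\mathcal S$ be given. Define $$\mathcal I_{\mathrm S}:=\Big\{i\in\mathcal I\ \Big|\ \min_{j\in\{1,\dots,n+1\}}V(x_{i,j})-\underline m(V)>0\ \text{ and }\ \max_{j\in\{1,\dots,n+1\}}W(x_{i,j})+\overline m(W)<0\Big\}.$$ Then $\mathbb X_{\mathrm S}:=\bigcup_{i\in\mathcal I_{\mathrm S}}\mathbb X_i$ is a stability region.
   Context: Let $n,n_{\mathrm u}\in\mathbb N$, let $\mathbb X\subset\mathbb R^n$ be a bounded closed set containing the origin, and let $\widetilde{\mathbb X}\subset\mathbb R^n$ be a bounded open set containing $\mathbb X$. Let $u:\mathbb R^n\to\mathbb R^{n_{\mathrm u}}$ (feedback controller), $\mu:\mathbb R^n\times\mathbb R^{n_{\mathrm u}}\to\mathbb R^n$ (nominal dynamics), $\sigma:\mathbb R^n\times\mathbb R^{n_{\mathrm u}}\to[0,\infty)^n$ (uncertainty). For a $C^1$ function $V$, put $$W(x):=\frac{\partial V(x)}{\partial x}^{\top}\mu(x,u(x))+\sum_{s=1}^n\Big|\Big[\frac{\partial V(x)}{\partial x}\Big]_s\Big|\,[\sigma(x,u(x))]_s .$$ A stability region (associated with $V,u,\mu,\sigma$) is a set $\mathbb X_{\mathrm S}\subseteq\mathbb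 X$ such that $V(x)>0$ and $W(x)<0$ for all $x\in\mathbb X_{\mathrm S}$. A simplex collection $\mathcal S=(\mathbb X_i)_{i\in\mathcal I}$ consists of a finite set $\mathcal I\subset\mathbb N$ and, for each $i\in\mathcal I$, vertices $x_{i,1},\dots,x_{i,n+1}\in\mathbb X$ such that $x_{i,j}-x_{i,n+1}$, $j=1,\dots,n$, are linearly independent; with $x_i(w):=\sum_{j=1}^{n+1}w_jx_{i,j}$ and $\mathbb X_i:=\{x_i(w): w_j\ge 0\ \forall j,\ \sum_{j=1}^{n+1}w_j=1\}$, it is required that $\mathbb X=\bigcup_{i\in\mathcal I}\mathbb X_i$. For continuous $\xi:\widetilde{\mathbb X}\to\mathbb R$, the linear interpolation $\xi^{\mathrm I}:\mathbb X\to\mathbb R$ is given by $\xi^{\mathrm I}(x_i(w)):=\sum_{j}w_j\xi(x_{i,j})$ for all $i$ and all $x_i(w)\in\mathbb X_i$ (simplex collections are understood to fit together so that this is well defined). Lower and upper margins of such a continuous $\xi$ are any numbers $\underline m(\xi)\ge0$, $\overline m(\xi)\ge 0$ with $-\underline m(\xi)\le \xi(x)-\xi^{\mathrm I}(x)\le\overline m(\xi)$ for all $x\in\mathbb X$. ($V$ and $W$ are restricted to $\widetilde{\mathbb X}$ when speaking of margins; the notion of margin presupposes continuity.) *)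

theory Defs
  imports "HOL-Analysis.Analysis"
begin

definition gradient :: "(real ^ 'n \<Rightarrow> real) \<Rightarrow> real ^ 'n \<Rightarrow> real ^ 'n" where
  "gradient V p = (THE D. GDERIV V p :> D)"

definition C1 :: "(real ^ 'n \<Rightarrow> real) \<Rightarrow> bool" where
  "C1 V \<longleftrightarrow> (\<forall>p. V differentiable (at p)) \<and> continuous_on UNIV (gradient V)"

definition W_fun ::
  "(real ^ 'n \<Rightarrow> real) \<Rightarrow> (real ^ 'n \<Rightarrow> real ^ 'm) \<Rightarrow> ((real ^ 'n) \<times> (real ^ 'm) \<Rightarrow> real ^ 'n)
     \<Rightarrow> ((real ^ 'n) \<times> (real ^ 'm) \<Rightarrow> real ^ 'n) \<Rightarrow> real ^ 'n \<Rightarrow> real" where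
  "W_fun V u \<mu> \<sigma> p =
     gradient V p \<bullet> \<mu> (p, u p) + (\<Sum>s\<in>UNIV. \<bar>gradient V p $ s\<bar> * \<sigma> (p, u p) $ s)"

definition stability_region ::
  "(real ^ 'n) set \<Rightarrow> (real ^ 'n \<Rightarrow> real) \<Rightarrow> (real ^ 'n \<Rightarrow> real ^ 'm)
     \<Rightarrow> ((real ^ 'n) \<times> (real ^ 'm) \<Rightarrow> real ^ 'n) \<Rightarrow> ((real ^ 'n) \<times> (real ^ 'm) \<Rightarrow> real ^ 'n)
     \<Rightarrow> (real ^ 'n) set \<Rightarrow> bool" where
  "stability_region X V u \<mu> \<sigma> S \<longleftrightarrow>
     S \<subseteq> X \<and> (\<forall>p\<in>S. V p > 0 \<and> W_fun V u \<mu> \<sigma> p < 0)"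

text \<open>A simplex in dimension \<open>n = CARD('n)\<close> is given by its vertices \<open>v 1, \<dots>, v (n + 1)\<close>;
  the values of \<open>v\<close>, and of a weight function \<open>w\<close>, at other indices are irrelevant.\<close>

definition weights :: "'n::finite itself \<Rightarrow> (nat \<Rightarrow> real) \<Rightarrow> bool" where
  "weights _ w \<longleftrightarrow>
     (\<forall>j\<in>{1..CARD('n) + 1}. w j \<ge> 0) \<and> (\<Sum>j = 1..CARD('n) + 1. w j) = 1"

definition point :: "(nat \<Rightarrow> real ^ 'n) \<Rightarrow> (nat \<Rightarrow> real) \<Rightarrow> real ^ 'n" where
  "point v w = (\<Sum>j = 1..CARD('n) + 1. w j *\<^sub>R v j)"

definition simplex_of :: "(nat \<Rightarrow> real ^ 'n) \<Rightarrow> (real ^ 'n) set" where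
  "simplex_of v = {point v w | w. weights TYPE('n) w}"

definition interp_value ::
  "(nat \<Rightarrow> real ^ 'n) \<Rightarrow> (real ^ 'n \<Rightarrow> real) \<Rightarrow> (nat \<Rightarrow> real) \<Rightarrow> real" where
  "interp_value v \<xi> w = (\<Sum>j = 1..CARD('n) + 1. w j * \<xi> (v j))"

text \<open>The last conjunct says that the simplices fit together, i.e. that linear interpolation of
  any continuous function on \<open>Xt\<close> is well defined.  The injectivity condition makes
  \<open>independent\<close>, a property of sets, express linear independence of the family.\<close>

definition simplex_collection ::
  "(real ^ 'n) set \<Rightarrow> (real ^ 'n) set \<Rightarrow> nat set \<Rightarrow> (nat \<Rightarrow> nat \<Rightarrow> real ^ 'n) \<Rightarrow> bool" where
  "simplex_collection X Xt I x \<longleftrightarrow>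
     finite I \<and>
     (\<forall>i\<in>I. \<forall>j\<in>{1..CARD('n) + 1}. x i j \<in> X) \<and>
     (\<forall>i\<in>I. inj_on (\<lambda>j. x i j - x i (CARD('n) + 1)) {1..CARD('n)} \<and>
             independent ((\<lambda>j. x i j - x i (CARD('n) + 1)) ` {1..CARD('n)})) \<and>
     X = (\<Union>i\<in>I. simplex_of (x i)) \<and>
     (\<forall>\<xi>. continuous_on Xt \<xi> \<longrightarrow>
        (\<forall>i\<in>I. \<forall>k\<in>I. \<forall>w w'. weights TYPE('n) w \<and> weights TYPE('n) w' \<and>
            point (x i) w = point (x k) w' \<longrightarrow>
            interp_value (x i) \<xi> w = interp_value (x k) \<xi> w'))"

definition interpolation ::
  "nat set \<Rightarrow> (nat \<Rightarrow> nat \<Rightarrow> real ^ 'n) \<Rightarrow> (real ^ 'n \<Rightarrow> real) \<Rightarrow> real ^ 'n \<Rightarrow> real" where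
  "interpolation I x \<xi> p =
     (THE y. \<exists>i\<in>I. \<exists>w. weights TYPE('n) w \<and> p = point (x i) w \<and> y = interp_value (x i) \<xi> w)"

lemma interpolation_point:
  fixes x :: "nat \<Rightarrow> nat \<Rightarrow> real ^ 'n"
  assumes "simplex_collection X Xt I x" "continuous_on Xt \<xi>" "i \<in> I" "weights TYPE('n) w"
  shows "interpolation I x \<xi> (point (x i) w) = interp_value (x i) \<xi> w"
  unfolding interpolation_def
proof (rule the_equality)
  show "\<exists>k\<in>I. \<exists>w'. weights TYPE('n) w' \<and> point (x i) w = point (x k) w' \<and>
          interp_value (x i) \<xi> w = interp_value (x k) \<xi> w'"
    using assms(3,4) by blast
next
  fix y
  assume "\<exists>k\<in>I. \<exists>w'. weights TYPE('n) w' \<and> point (x i) w = point (x k) w' \<and>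
            y = interp_value (x k) \<xi> w'"
  then obtain k w' where "k \<in> I" "weights TYPE('n) w'" "point (x i) w = point (x k) w'"
    "y = interp_value (x k) \<xi> w'"
    by blast
  with assms show "y = interp_value (x i) \<xi> w"
    unfolding simplex_collection_def by metis
qed

definition lower_margin ::
  "(real ^ 'n) set \<Rightarrow> (real ^ 'n) set \<Rightarrow> nat set \<Rightarrow> (nat \<Rightarrow> nat \<Rightarrow> real ^ 'n)
     \<Rightarrow> (real ^ 'n \<Rightarrow> real) \<Rightarrow> real \<Rightarrow> bool" where
  "lower_margin X Xt I x \<xi> m \<longleftrightarrow>
     continuous_on Xt \<xi> \<and> m \<ge> 0 \<and> (\<forall>p\<in>X. - m \<le> \<xi> p - interpolation I x \<xi> p)"

definition upper_margin ::
  "(real ^ 'n) set \<Rightarrow> (real ^ 'n) set \<Rightarrow> nat set \<Rightarrow> (nat \<Rightarrow> nat \<Rightarrow> real ^ 'n)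
     \<Rightarrow> (real ^ 'n \<Rightarrow> real) \<Rightarrow> real \<Rightarrow> bool" where
  "upper_margin X Xt I x \<xi> m \<longleftrightarrow>
     continuous_on Xt \<xi> \<and> m \<ge> 0 \<and> (\<forall>p\<in>X. \<xi> p - interpolation I x \<xi> p \<le> m)"

definition stable_indices ::
  "nat set \<Rightarrow> (nat \<Rightarrow> nat \<Rightarrow> real ^ 'n) \<Rightarrow> (real ^ 'n \<Rightarrow> real) \<Rightarrow> (real ^ 'n \<Rightarrow> real)
     \<Rightarrow> real \<Rightarrow> real \<Rightarrow> nat set" where
  "stable_indices I x V W mV mW =
     {i \<in> I. (MIN j\<in>{1..CARD('n) + 1}. V (x i j)) - mV > 0 \<and>
             (MAX j\<in>{1..CARD('n) + 1}. W (x i j)) + mW < 0}"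

end

theory Submission
  imports Defs
begin

text \<open>
  A linear interpolant attains its extrema over a simplex at the vertices, because its values there
  are convex combinations of the vertex values (\<open>interp_value_ge\<close>, \<open>interp_value_le\<close>). A margin
  turns such a bound on the interpolant into a bound on the interpolated function: on a simplex, \<open>V\<close> is at least its smallest vertex value
  minus its lower margin, and \<open>W\<close> is at most its largest vertex value plus its upper margin
  (\<open>lower_margin_vertex_bound\<close>, \<open>upper_margin_vertex_bound\<close>).
  The indices selected are exactly those for which these two bounds have the required strict sign.
  This makes \<open>V\<close> positive and \<open>W\<close> negative on each whole simplex, not only at its vertices.
\<close>

lemma interp_value_ge:
  fixes v :: "nat \<Rightarrow> real ^ 'n"
  assumes w: "weights TYPE('n) w" and c: "\<And>j. j \<in> {1..CARD('n) + 1} \<Longrightarrow> c \<le> \<xi> (v j)"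
  shows "c \<le> interp_value v \<xi> w"
proof -
  have "c = (\<Sum>j = 1..CARD('n) + 1. w j) * c"
    using w by (simp only: weights_def mult_1)
  also have "\<dots> = (\<Sum>j = 1..CARD('n) + 1. w j * c)"
    by (rule sum_distrib_right)
  also have "\<dots> \<le> (\<Sum>j = 1..CARD('n) + 1. w j * \<xi> (v j))"
    using w c unfolding weights_def by (intro sum_mono mult_left_mono) blast+
  finally show ?thesis
    unfolding interp_value_def .
qed

lemma interp_value_le:
  fixes v :: "nat \<Rightarrow> real ^ 'n"
  assumes "weights TYPE('n) w" and "\<And>j. j \<in> {1..CARD('n) + 1} \<Longrightarrow> \<xi> (v j) \<le> c"
  shows "interp_value v \<xi> w \<le> c"
proof -
  have "- c \<le> interp_value v (\<lambda>p. - \<xi> p) w"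
    using assms by (intro interp_value_ge) auto
  then show ?thesis
    by (simp add: interp_value_def sum_negf del: sum.cl_ivl_Suc)
qed

lemma simplex_subset:
  assumes "simplex_collection X Xt I x" "i \<in> I"
  shows "simplex_of (x i) \<subseteq> X"
  using assms unfolding simplex_collection_def by blast

text \<open>
  The next two bounds turn data at finitely many vertices into estimates on the whole simplex.
  In a simplex collection, continuity, which is part of being a margin, makes the interpolation at \<open>p\<close> independent
  of the simplex and of the weights that represent \<open>p\<close>. It can therefore be evaluated with the
  weights of \<open>p\<close> in the given simplex.
\<close>

lemma lower_margin_vertex_bound:
  fixes x :: "nat \<Rightarrow> nat \<Rightarrow> real ^ 'n"
  assumes S: "simplex_collection X Xt I x" and m: "lower_margin X Xt I x \<xi> m"
    and i: "i \<in> I" and p: "p \<in> simplex_of (x i)"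
  shows "(MIN j\<in>{1..CARD('n) + 1}. \<xi> (x i j)) - m \<le> \<xi> p"
proof -
  from p obtain w where w: "weights TYPE('n) w" and pw: "p = point (x i) w"
    unfolding simplex_of_def by blast
  have "(MIN j\<in>{1..CARD('n) + 1}. \<xi> (x i j)) \<le> interp_value (x i) \<xi> w"
    using w by (intro interp_value_ge Min_le) auto
  also have "\<dots> = interpolation I x \<xi> p"
    using interpolation_point[OF S _ i w, of \<xi>] m pw unfolding lower_margin_def by simp
  also have "\<dots> \<le> \<xi> p + m"
    using m simplex_subset[OF S i] p unfolding lower_margin_def by force
  finally show ?thesis
    by simp
qed

lemma upper_margin_vertex_bound:
  fixes x :: "nat \<Rightarrow> nat \<Rightarrow> real ^ 'n"
  assumes S: "simplex_collection X Xt I x" and m: "upper_margin X Xt I x \<xi> m"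
    and i: "i \<in> I" and p: "p \<in> simplex_of (x i)"
  shows "\<xi> p \<le> (MAX j\<in>{1..CARD('n) + 1}. \<xi> (x i j)) + m"
proof -
  from p obtain w where w: "weights TYPE('n) w" and pw: "p = point (x i) w"
    unfolding simplex_of_def by blast
  have "\<xi> p \<le> interpolation I x \<xi> p + m"
    using m simplex_subset[OF S i] p unfolding upper_margin_def by force
  also have "interpolation I x \<xi> p = interp_value (x i) \<xi> w"
    using interpolation_point[OF S _ i w, of \<xi>] m pw unfolding upper_margin_def by simp
  also have "\<dots> \<le> (MAX j\<in>{1..CARD('n) + 1}. \<xi> (x i j))"
    using w by (intro interp_value_le Max_ge) auto
  finally show ?thesis
    by simp
qed

theorem theorem8:
  fixes X Xt :: "(real ^ 'n) set"
    and u :: "real ^ 'n \<Rightarrow> real ^ 'm"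
    and \<mu> \<sigma> :: "(real ^ 'n) \<times> (real ^ 'm) \<Rightarrow> real ^ 'n"
    and V :: "real ^ 'n \<Rightarrow> real"
    and I :: "nat set"
    and x :: "nat \<Rightarrow> nat \<Rightarrow> real ^ 'n"
    and mV mW :: real
  assumes "bounded X" "closed X" "0 \<in> X"
    and "bounded Xt" "open Xt" "X \<subseteq> Xt"
    and "\<And>z s. \<sigma> z $ s \<ge> 0"
    and "C1 V"
    and "simplex_collection X Xt I x"
    and "lower_margin X Xt I x V mV"
    and "upper_margin X Xt I x (W_fun V u \<mu> \<sigma>) mW"
  shows "stability_region X V u \<mu> \<sigma>
           (\<Union>i\<in>stable_indices I x V (W_fun V u \<mu> \<sigma>) mV mW. simplex_of (x i))"
  unfolding stability_region_def
proof (intro conjI ballI subsetI)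
  let ?W = "W_fun V u \<mu> \<sigma>"
  fix p
  assume "p \<in> (\<Union>i\<in>stable_indices I x V ?W mV mW. simplex_of (x i))"
  then obtain i where i: "i \<in> I" and p: "p \<in> simplex_of (x i)"
    and V: "(MIN j\<in>{1..CARD('n) + 1}. V (x i j)) - mV > 0"
    and W: "(MAX j\<in>{1..CARD('n) + 1}. ?W (x i j)) + mW < 0"
    unfolding stable_indices_def by blast
  show "p \<in> X"
    using simplex_subset[OF assms(9) i] p by blast
  show "V p > 0"
    using V lower_margin_vertex_bound[OF assms(9,10) i p] by linarith
  show "?W p < 0"
    using W upper_margin_vertex_bound[OF assms(9,11) i p] by linarith
qed

end
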